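(* Let $p\in(0,1)$, $r\in(0,1)$ ($r=\frac12$ being the symmetric case and $r\ne\frac12$ the asymmetric case), and let $m$ be a gamma distribution (with arbitrary shape and scale parameters). Consider ballistic annihilation with random lengths of law $m$ and velocities of law $(1-r)(1-p)\delta_{-1}+p\,\delta_0+r(1-p)\delta_{+1}$. Then for all $n\ge1$, the random variable $x_n$ and the whole combinatorial configuration $(v,\pi)$ of the first $n$ particles (velocities $v=(v_1,\dots,v_n)$ and pairing $\pi$) are independent.
   Context: **Model (random lengths).** Let $(\ell_k)_{k\ge1}$ be i.i.d. with law $m$ and $(v_k)_{k\ge1}$ i.i.d. with law $(1-r)(1-p)\delta_{-1}+p\,\delta_0+r(1-p)\delta_{+1}$, the two sequences being independent. Put $x_n=\ell_1+\cdots+\ell_n$. **Dynamics (restricted to the first $n$ particles).** At time $0$, particles $\bullet_1,\dots,\bullet_n$ start at $x_1<\dots<x_n$ on the real line and move at constant velocities $v_1,\dots,v_n$ until they are annihilated; when two (not yet annihilated) particles meet, both are annihilated and removed from the system. Triple collisions almost surely do not occur since $m$ has no atoms (in general they are resolved by an independent fair coin attached to the static particle, choosing which of the two moving particles survives). **Pairing.** The pairing $\pi$ is the random involution of $\{1,\dots,n\}$ defined by $\pi(i)=j$ if $\bullet_i$ and $\bullet_j$ annihilate each other, and $\pi(i)=i$ if $\bullet_i$ is never annihilated. *)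

theory Defs
  imports "HOL-Probability.Probability"
begin

text \<open>
  Independence of two random variables with possibly different value types; the library's
  \<open>indep_var\<close> requires both to take values in the same type.
\<close>

definition indep_rvs ::
    "'a measure \<Rightarrow> 'b measure \<Rightarrow> ('a \<Rightarrow> 'b) \<Rightarrow> 'c measure \<Rightarrow> ('a \<Rightarrow> 'c) \<Rightarrow> bool" where
  "indep_rvs M S X T Y \<longleftrightarrow>
     X \<in> measurable M S \<and> Y \<in> measurable M T \<and>
     prob_space.indep_set M {X -` A \<inter> space M |A. A \<in> sets S} {Y -` B \<inter> space M |B. B \<in> sets T}"

definition gamma_density :: "real \<Rightarrow> real \<Rightarrow> real \<Rightarrow> real" where
  "gamma_density a \<theta> x =
     (if x > 0 then x powr (a - 1) * exp (- x / \<theta>) / (Gamma a * \<theta> powr a) else 0)"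

definition velocity_pmf :: "real \<Rightarrow> real \<Rightarrow> int pmf" where
  "velocity_pmf p r = pmf_of_list [(-1, (1 - r) * (1 - p)), (0, p), (1, r * (1 - p))]"

lemma velocity_pmf_wf:
  fixes p r :: real
  assumes "0 < p" "p < 1" "0 < r" "r < 1"
  shows "pmf_of_list_wf [(-1 :: int, (1 - r) * (1 - p)), (0, p), (1, r * (1 - p))]"
proof -
  have "(1 - r) * (1 - p) + (p + r * (1 - p)) = 1"
    by algebra
  then show ?thesis
    using assms by (auto simp: pmf_of_list_wf_def)
qed

text \<open>
  In what follows \<open>x\<close> gives the initial positions, \<open>v\<close> the velocities, and \<open>c j\<close> is the coin of
  particle \<open>j\<close>: it is consulted only when \<open>j\<close> is static and is hit from both sides at the same
  time, and \<open>c j = True\<close> means that the right-moving particle (coming from the left) survives.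
  The definitions are meant for strictly increasing \<open>x\<close> and velocities in \<open>{-1, 0, 1}\<close>.
\<close>

definition approaching :: "(nat \<Rightarrow> int) \<Rightarrow> nat set \<Rightarrow> (nat \<times> nat) set" where
  "approaching v A = {(i, j). i \<in> A \<and> j \<in> A \<and> i < j \<and> v j < v i}"

text \<open>The solution \<open>t\<close> of \<open>x i + v i * t = x j + v j * t\<close>.\<close>

definition meeting_time :: "(nat \<Rightarrow> real) \<Rightarrow> (nat \<Rightarrow> int) \<Rightarrow> nat \<times> nat \<Rightarrow> real" where
  "meeting_time x v = (\<lambda>(i, j). (x j - x i) / real_of_int (v i - v j))"

definition first_meetings ::
    "(nat \<Rightarrow> real) \<Rightarrow> (nat \<Rightarrow> int) \<Rightarrow> nat set \<Rightarrow> (nat \<times> nat) set" where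
  "first_meetings x v A =
     {e \<in> approaching v A. meeting_time x v e = Min (meeting_time x v ` approaching v A)}"

text \<open>
  If three particles \<open>i < k < j\<close> meet in one point, then \<open>k\<close> is the static one and
  \<open>(i, k)\<close>, \<open>(k, j)\<close> and \<open>(i, j)\<close> all belong to \<open>first_meetings\<close>. The pair \<open>(i, j)\<close> is discarded,
  and the coin of \<open>k\<close> selects one of the other two.
\<close>

definition first_annihilations ::
    "(nat \<Rightarrow> real) \<Rightarrow> (nat \<Rightarrow> int) \<Rightarrow> (nat \<Rightarrow> bool) \<Rightarrow> nat set \<Rightarrow> (nat \<times> nat) set" where
  "first_annihilations x v c A =
     {(i, j). (i, j) \<in> first_meetings x v A \<and>
        (\<nexists>k. (i, k) \<in> first_meetings x v A \<and> (k, j) \<in> first_meetings x v A) \<and>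
        (\<forall>k. (j, k) \<in> first_meetings x v A \<longrightarrow> \<not> c j) \<and>
        (\<forall>k. (k, i) \<in> first_meetings x v A \<longrightarrow> c i)}"

text \<open>
  Pairs annihilated during the first \<open>k\<close> collision times of the system of particles \<open>1, ..., n\<close>.
  As velocities stay constant until annihilation, meeting times computed from the initial
  positions remain valid for the surviving particles.
\<close>

primrec annihilations ::
    "nat \<Rightarrow> (nat \<Rightarrow> real) \<Rightarrow> (nat \<Rightarrow> int) \<Rightarrow> (nat \<Rightarrow> bool) \<Rightarrow> nat \<Rightarrow> (nat \<times> nat) set" where
  "annihilations n x v c 0 = {}"
| "annihilations n x v c (Suc k) =
     annihilations n x v c k \<union>
     first_annihilations x v c ({1..n} - Field (annihilations n x v c k))"

definition annihilated ::
    "nat \<Rightarrow> (nat \<Rightarrow> real) \<Rightarrow> (nat \<Rightarrow> int) \<Rightarrow> (nat \<Rightarrow> bool) \<Rightarrow> nat \<Rightarrow> nat \<Rightarrow> bool" where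
  "annihilated n x v c i j \<longleftrightarrow>
     (\<exists>k. (i, j) \<in> annihilations n x v c k \<or> (j, i) \<in> annihilations n x v c k)"

text \<open>
  The pairing \<open>\<pi>\<close>; following the convention for permutations of \<open>{1..n}\<close>,
  it is the identity outside \<open>{1..n}\<close>.
\<close>

definition pairing ::
    "nat \<Rightarrow> (nat \<Rightarrow> real) \<Rightarrow> (nat \<Rightarrow> int) \<Rightarrow> (nat \<Rightarrow> bool) \<Rightarrow> nat \<Rightarrow> nat" where
  "pairing n x v c i =
     (if \<exists>j. annihilated n x v c i j then THE j. annihilated n x v c i j else i)"

end

theory Submission
  imports Defs
begin

text \<open>
  The pairing depends on the initial positions only through the order in which the
  \<open>meeting_time\<close>s of the pairs of particles occur (\<open>pairing_eqI\<close>). This order does not change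
  when all the lengths are multiplied by the same positive number. So for given velocities and
  coins, the pairing is a function of the direction of the vector \<open>(l 1, ..., l n)\<close>, and it
  remains to see that this direction is independent of the sum of the lengths. This is a
  characteristic property of gamma laws, and the only place where the law of the lengths enters.

  Here is why the property holds. Up to a constant, the density of the gamma law is
  \<open>y powr (a - 1) * exp (- y / \<theta>)\<close>. In the \<open>n\<close>-fold product, the exponential factors combine to
  a function of the sum \<open>S\<close> alone, and the power factors give a measure \<open>N\<close> that is homogeneous
  of degree \<open>d = a * n\<close>: dilating a set by \<open>s\<close> multiplies its measure by \<open>s powr d\<close>
  (\<open>homogeneous_PiM\<close>). If \<open>B\<close> is a cone, the image under \<open>S\<close> of the restriction of \<open>N\<close> to \<open>B\<close>
  therefore gives to \<open>{..s}\<close>, \<open>s > 0\<close>, the mass \<open>s powr d\<close> times its mass of \<open>{..1}\<close>. Thus all cones lead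
  to the same measure on the line up to a constant factor, whence \<open>S\<close> and \<open>B\<close> are independent
  once \<open>N\<close> is turned into a probability by a function of \<open>S\<close> (\<open>homogeneous_measure_independence\<close>). This
  avoids both the Dirichlet density of \<open>(l 1, ..., l n) / S\<close> and Laplace transforms.

  The velocities and coins of the first \<open>n\<close> particles take countably many values and are
  independent of the lengths, so that one can sum over their values (\<open>indep_rvs_mixture\<close>).
  Coincidences of meeting times need no separate treatment, as they too are preserved by
  dilations.
\<close>

section \<open>Homogeneous measures\<close>

text \<open>
  The degrees of homogeneity of the factors add up. It suffices to check this on boxes: dilating
  a product measure and dividing by the expected factor gives a measure that agrees with the
  product measure on all boxes.
\<close>

lemma homogeneous_PiM:
  fixes K :: "real measure" and I :: "'i set" and a t :: real
  assumes fin: "finite I" and "sigma_finite_measure K" and sets_K[measurable_cong]: "sets K = sets borel"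
    and hom: "\<And>A. A \<in> sets borel \<Longrightarrow> emeasure K ((\<lambda>y. y / t) -` A) = ennreal (t powr a) * emeasure K A"
    and t: "0 < t" and B: "B \<in> sets (PiM I (\<lambda>_. K))"
  shows "emeasure (PiM I (\<lambda>_. K)) {w \<in> space (PiM I (\<lambda>_. K)). (\<lambda>i\<in>I. w i / t) \<in> B} =
    ennreal (t powr (a * card I)) * emeasure (PiM I (\<lambda>_. K)) B"
proof -
  interpret product_sigma_finite "\<lambda>_ :: 'i. K"
    using assms(2) by (simp add: product_sigma_finite_def)
  let ?N = "PiM I (\<lambda>_. K)"
  let ?f = "\<lambda>w. \<lambda>i\<in>I. w i / t"
  define d where "d = a * card I"
  have [simp]: "space K = UNIV"
    using sets_eq_imp_space_eq[OF sets_K] by simp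
  have f[measurable]: "?f \<in> measurable ?N ?N"
    by measurable
  define P where "P = density (distr ?N ?N ?f) (\<lambda>_. ennreal (t powr - d))"
  have emP: "emeasure P C = ennreal (t powr - d) * emeasure ?N {w \<in> space ?N. ?f w \<in> C}"
    if "C \<in> sets ?N" for C
    using that unfolding P_def
    by (subst emeasure_density_const) (auto simp: emeasure_distr vimage_def Int_def conj_commute)
  have "P = ?N"
  proof (rule PiM_eqI[OF fin])
    show "sets P = sets ?N"
      by (simp add: P_def)
    fix A :: "'i \<Rightarrow> real set"
    assume "\<And>i. i \<in> I \<Longrightarrow> A i \<in> sets K"
    then have A: "A i \<in> sets borel" if "i \<in> I" for i
      using that sets_K by simp
    have "{w \<in> space ?N. ?f w \<in> Pi\<^sub>E I A} = (\<Pi>\<^sub>E i\<in>I. (\<lambda>y. y / t) -` A i)"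
      by (auto simp: space_PiM PiE_iff extensional_def)
    moreover have "(\<lambda>y. y / t) -` A i \<in> sets borel" if "i \<in> I" for i
      using measurable_sets[of "\<lambda>y. y / t" borel borel, OF _ A[OF that]] by simp
    moreover have "Pi\<^sub>E I A \<in> sets ?N"
      using A fin by (intro sets_PiM_I_finite) (auto simp: sets_K)
    ultimately have "emeasure P (Pi\<^sub>E I A) =
        ennreal (t powr - d) * (\<Prod>i\<in>I. emeasure K ((\<lambda>y. y / t) -` A i))"
      using fin by (simp only: emP) (subst emeasure_PiM, auto simp: sets_K)
    also have "\<dots> = ennreal (t powr - d) * (ennreal (t powr d) * (\<Prod>i\<in>I. emeasure K (A i)))"
      using A t by (simp add: hom prod.distrib ennreal_power d_def powr_powr powr_realpow[symmetric])
    also have "\<dots> = (\<Prod>i\<in>I. emeasure K (A i))"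
      using t by (simp add: mult.assoc[symmetric] ennreal_mult[symmetric] powr_add[symmetric])
    finally show "emeasure P (Pi\<^sub>E I A) = (\<Prod>i\<in>I. emeasure K (A i))" .
  qed
  then have "ennreal (t powr d) * emeasure ?N B =
      ennreal (t powr d) * (ennreal (t powr - d) * emeasure ?N {w \<in> space ?N. ?f w \<in> B})"
    using emP[OF B] by simp
  also have "\<dots> = emeasure ?N {w \<in> space ?N. ?f w \<in> B}"
    using t by (simp add: mult.assoc[symmetric] ennreal_mult[symmetric] powr_add[symmetric])
  finally show ?thesis
    by (simp add: d_def)
qed

text \<open>
  The images under \<open>S\<close> of the restrictions of \<open>N\<close> to \<open>B\<close> and to the whole space have distribution
  functions proportional to \<open>s powr d\<close> on the positive half-line, so they are proportional to
  each other. Reweighting by \<open>h (S w)\<close> multiplies both by the density \<open>h\<close>, and the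
  normalisation turns the constant of proportionality into the probability of \<open>B\<close>.
\<close>

lemma homogeneous_measure_independence:
  fixes N :: "'b measure" and S :: "'b \<Rightarrow> real" and h :: "real \<Rightarrow> ennreal"
  assumes S[measurable]: "S \<in> borel_measurable N" and h[measurable]: "h \<in> borel_measurable borel"
    and B[measurable]: "B \<in> sets N" and A[measurable]: "A \<in> sets borel"
    and pos: "AE w in N. 0 < S w"
    and fin: "emeasure N {w \<in> space N. S w \<le> 1} \<noteq> \<infinity>"
    and hom: "\<And>D s. D \<in> {B, space N} \<Longrightarrow> 0 < s \<Longrightarrow>
      emeasure N {w \<in> D. S w \<le> s} = ennreal (s powr d) * emeasure N {w \<in> D. S w \<le> 1}"
    and prob: "prob_space (density N (\<lambda>w. h (S w)))"
  shows "emeasure (density N (\<lambda>w. h (S w))) {w \<in> B. S w \<in> A} =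
    emeasure (density N (\<lambda>w. h (S w))) B * emeasure (density N (\<lambda>w. h (S w))) {w \<in> space N. S w \<in> A}"
proof -
  let ?L = "density N (\<lambda>w. h (S w))"
  define \<nu> where "\<nu> D = distr (density N (indicator D)) borel S" for D
  define \<alpha> where "\<alpha> D = emeasure N {w \<in> D. S w \<le> 1}" for D
  have BN: "D \<in> sets N" if "D \<in> {B, space N}" for D
    using that by auto
  have \<nu>_sets[simp, measurable_cong]: "sets (\<nu> D) = sets borel" for D
    by (simp add: \<nu>_def)
  have \<nu>_atMost: "emeasure (\<nu> D) {..s} = emeasure N {w \<in> D. S w \<le> s}" if "D \<in> {B, space N}" for D s
  proof -
    have D[measurable]: "D \<in> sets N"
      using that by (rule BN)
    have "emeasure (\<nu> D) {..s} = emeasure (density N (indicator D)) {w \<in> space N. S w \<le> s}"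
      unfolding \<nu>_def by (subst emeasure_distr) (auto intro!: arg_cong2[where f=emeasure])
    also have "\<dots> = (\<integral>\<^sup>+w. indicator {w \<in> D. S w \<le> s} w \<partial>N)"
      by (subst emeasure_density; (rule nn_integral_cong)?) (auto simp: indicator_def)
    also have "\<dots> = emeasure N {w \<in> D. S w \<le> s}"
    proof (rule nn_integral_indicator)
      have "{w \<in> D. S w \<le> s} = D \<inter> {w \<in> space N. S w \<le> s}"
        using sets.sets_into_space[OF D] by auto
      then show "{w \<in> D. S w \<le> s} \<in> sets N"
        by simp
    qed
    finally show ?thesis .
  qed
  have atMost_eq: "emeasure (\<nu> D) {..s} = (if 0 < s then ennreal (s powr d) * \<alpha> D else 0)"
    if D: "D \<in> {B, space N}" for D s
  proof (cases "0 < s")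
    case True
    then show ?thesis
      using hom[OF D True] by (simp add: \<nu>_atMost[OF D] \<alpha>_def)
  next
    case False
    have "{w \<in> D. S w \<le> s} = D \<inter> {w \<in> space N. S w \<le> s}"
      using sets.sets_into_space[OF BN[OF D]] by auto
    then have "{w \<in> D. S w \<le> s} \<in> sets N"
      using BN[OF D] by simp
    moreover have "AE w in N. w \<notin> {w \<in> D. S w \<le> s}"
      using pos by eventually_elim (use False in auto)
    ultimately have "emeasure N {w \<in> D. S w \<le> s} = 0"
      by (metis AE_iff_null_sets null_setsD1)
    then show ?thesis
      using False by (simp add: \<nu>_atMost[OF D])
  qed
  have \<alpha>_fin: "\<alpha> D < \<infinity>" if D: "D \<in> {B, space N}" for D
  proof -
    have "\<alpha> D \<le> emeasure N {w \<in> space N. S w \<le> 1}"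
      unfolding \<alpha>_def using sets.sets_into_space[OF BN[OF D]] by (intro emeasure_mono) auto
    then show ?thesis
      using fin by (simp add: order_le_less_trans less_top)
  qed
  \<comment> \<open>Cross-multiplied, as \<open>\<alpha> (space N)\<close> is only later seen to be nonzero.\<close>
  have proportional: "density (\<nu> B) (\<lambda>_. \<alpha> (space N)) = density (\<nu> (space N)) (\<lambda>_. \<alpha> B)"
  proof (rule measure_eqI_generator_eq[where E="range (\<lambda>a. {..a::real})" and \<Omega>=UNIV
        and A="\<lambda>k. {..real k}"])
    show "Int_stable (range (\<lambda>a. {..a::real}))"
      by (auto simp: Int_stable_def)
    have "sets borel = sigma_sets UNIV (range (\<lambda>a. {..a::real}))"
      by (subst borel_eq_atMost) simp
    then show "sets (density (\<nu> B) (\<lambda>_. \<alpha> (space N))) = sigma_sets UNIV (range (\<lambda>a. {..a::real}))"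
      and "sets (density (\<nu> (space N)) (\<lambda>_. \<alpha> B)) = sigma_sets UNIV (range (\<lambda>a. {..a::real}))"
      by simp_all
    show "(\<Union>k. {..real k}) = UNIV"
      by (auto intro: real_arch_simple)
    show "emeasure (density (\<nu> B) (\<lambda>_. \<alpha> (space N))) {..real k} \<noteq> \<infinity>" for k
      using \<alpha>_fin[of B] \<alpha>_fin[of "space N"]
      by (auto simp: emeasure_density_const atMost_eq ennreal_mult_eq_top_iff)
  next
    fix X assume "X \<in> range (\<lambda>a. {..a::real})"
    then show "emeasure (density (\<nu> B) (\<lambda>_. \<alpha> (space N))) X =
        emeasure (density (\<nu> (space N)) (\<lambda>_. \<alpha> B)) X"
      by (auto simp: emeasure_density_const atMost_eq mult.commute mult.left_commute)
  qed auto
  have L_eq: "c * emeasure ?L {w \<in> D. S w \<in> C} =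
      (\<integral>\<^sup>+s. h s * indicator C s \<partial>density (\<nu> D) (\<lambda>_. c))"
    if D: "D \<in> {B, space N}" and C[measurable]: "C \<in> sets borel" for c C D
  proof -
    have [measurable]: "D \<in> sets N"
      using D by (rule BN)
    have eq: "{w \<in> D. S w \<in> C} = D \<inter> (S -` C \<inter> space N)"
      using sets.sets_into_space[OF BN[OF D]] by auto
    have "emeasure ?L {w \<in> D. S w \<in> C} = (\<integral>\<^sup>+w. indicator D w * (h (S w) * indicator C (S w)) \<partial>N)"
      unfolding eq by (subst emeasure_density) (auto intro!: nn_integral_cong simp: indicator_def)
    also have "\<dots> = (\<integral>\<^sup>+s. h s * indicator C s \<partial>\<nu> D)"
      unfolding \<nu>_def by (simp add: nn_integral_distr nn_integral_density)
    finally show ?thesis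
      by (simp add: nn_integral_density nn_integral_cmult)
  qed
  have key: "\<alpha> (space N) * emeasure ?L {w \<in> B. S w \<in> C} = \<alpha> B * emeasure ?L {w \<in> space N. S w \<in> C}"
    if "C \<in> sets borel" for C
    using that by (simp add: L_eq proportional)
  interpret L: prob_space ?L
    by (rule prob)
  have total: "emeasure ?L (space N) = 1"
    using L.emeasure_space_1 by simp
  have \<alpha>_B: "\<alpha> (space N) * emeasure ?L B = \<alpha> B"
    using key[of UNIV] total by simp
  \<comment> \<open>Otherwise the image of \<open>N\<close> under \<open>S\<close> vanishes on every \<open>{..k}\<close>, and no density can make it a probability.\<close>
  have "\<alpha> (space N) \<noteq> 0"
  proof
    assume 0: "\<alpha> (space N) = 0"
    have "emeasure (\<nu> (space N)) (\<Union>k. {..real k}) = 0"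
      by (intro emeasure_UN_eq_0) (auto simp: atMost_eq 0)
    moreover have "(\<Union>k. {..real k}) = UNIV"
      by (auto intro: real_arch_simple)
    ultimately have "emeasure (\<nu> (space N)) (space (\<nu> (space N))) = 0"
      by (simp add: \<nu>_def)
    then have "UNIV \<in> null_sets (\<nu> (space N))"
      by (auto simp: null_sets_def \<nu>_def)
    then have "AE s in \<nu> (space N). s \<notin> UNIV"
      by (rule AE_not_in)
    then have "(\<integral>\<^sup>+s. h s \<partial>\<nu> (space N)) = 0"
      by (subst nn_integral_0_iff_AE) auto
    then have "emeasure ?L (space N) = 0"
      using L_eq[of "space N" UNIV 1] by (simp add: density_1)
    with total show False
      by simp
  qed
  moreover have "\<alpha> (space N) * emeasure ?L {w \<in> B. S w \<in> A} =
      \<alpha> (space N) * (emeasure ?L B * emeasure ?L {w \<in> space N. S w \<in> A})"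
    using key[OF A] by (simp add: \<alpha>_B[symmetric] mult.assoc)
  ultimately show ?thesis
    using \<alpha>_fin[of "space N"] by (auto simp: ennreal_mult_cancel_left)
qed

section \<open>Sums of gamma variables and scale-invariant events\<close>

text \<open>
  This is what separates the exponential factors of the gamma densities, whose product is a
  function of the sum, from the power factors.
\<close>

lemma density_PiM:
  assumes fin: "finite I" and K: "sigma_finite_measure K" and hK: "sigma_finite_measure (density K h)"
    and h[measurable]: "h \<in> borel_measurable K"
  shows "PiM I (\<lambda>_. density K h) = density (PiM I (\<lambda>_. K)) (\<lambda>w. \<Prod>i\<in>I. h (w i))"
proof (rule sym, rule product_sigma_finite.PiM_eqI)
  interpret product_sigma_finite "\<lambda>_. K"
    using K by (simp add: product_sigma_finite_def)
  show "product_sigma_finite (\<lambda>_. density K h)"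
    using hK by (simp add: product_sigma_finite_def)
  show "sets (density (PiM I (\<lambda>_. K)) (\<lambda>w. \<Prod>i\<in>I. h (w i))) = sets (PiM I (\<lambda>_. density K h))"
    by (auto intro!: sets_PiM_cong)
  fix A assume "\<And>i. i \<in> I \<Longrightarrow> A i \<in> sets (density K h)"
  then have A[measurable]: "A i \<in> sets K" if "i \<in> I" for i
    using that by simp
  have "emeasure (density (PiM I (\<lambda>_. K)) (\<lambda>w. \<Prod>i\<in>I. h (w i))) (Pi\<^sub>E I A) =
      (\<integral>\<^sup>+w. (\<Prod>i\<in>I. h (w i)) * indicator (Pi\<^sub>E I A) w \<partial>PiM I (\<lambda>_. K))"
    using fin by (intro emeasure_density) (auto intro!: sets_PiM_I_finite)
  also have "\<dots> = (\<integral>\<^sup>+w. (\<Prod>i\<in>I. h (w i) * indicator (A i) (w i)) \<partial>PiM I (\<lambda>_. K))"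
  proof (rule nn_integral_cong)
    fix w assume "w \<in> space (PiM I (\<lambda>_. K))"
    then have "indicator (Pi\<^sub>E I A) w = (\<Prod>i\<in>I. indicator (A i) (w i) :: ennreal)"
      using fin by (auto simp: space_PiM PiE_iff indicator_def prod_zero)
    then show "(\<Prod>i\<in>I. h (w i)) * indicator (Pi\<^sub>E I A) w = (\<Prod>i\<in>I. h (w i) * indicator (A i) (w i))"
      by (simp add: prod.distrib)
  qed
  also have "\<dots> = (\<Prod>i\<in>I. \<integral>\<^sup>+y. h y * indicator (A i) y \<partial>K)"
    using fin by (intro product_nn_integral_prod) auto
  also have "\<dots> = (\<Prod>i\<in>I. emeasure (density K h) (A i))"
    by (intro prod.cong) (auto simp: emeasure_density)
  finally show "emeasure (density (PiM I (\<lambda>_. K)) (\<lambda>w. \<Prod>i\<in>I. h (w i))) (Pi\<^sub>E I A) =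
      (\<Prod>i\<in>I. emeasure (density K h) (A i))" .
qed (rule fin)

text \<open>
  The gamma law without its exponential factor and its normalisation; its total mass is infinite.
\<close>

definition power_law :: "real \<Rightarrow> real measure" where
  "power_law a = density lborel (\<lambda>y. ennreal (indicator {0<..} y * y powr (a - 1)))"

lemma sets_power_law[simp, measurable_cong]: "sets (power_law a) = sets borel"
  by (simp add: power_law_def)

lemma space_power_law[simp]: "space (power_law a) = UNIV"
  by (simp add: power_law_def)

lemma sigma_finite_power_law: "sigma_finite_measure (power_law a)"
  unfolding power_law_def 
  by (subst sigma_finite_measure.sigma_finite_iff_density_finite[OF sigma_finite_lborel]) auto

lemma homogeneous_power_law:
  assumes t: "0 < t" and A[measurable]: "A \<in> sets borel"
  shows "emeasure (power_law a) ((\<lambda>y. y / t) -` A) = ennreal (t powr a) * emeasure (power_law a) A"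
proof -
  have [measurable]: "(\<lambda>y. y / t) -` A \<in> sets borel"
    using measurable_sets[of "\<lambda>y. y / t" borel borel, OF _ A] by simp
  have "emeasure (power_law a) ((\<lambda>y. y / t) -` A) =
      (\<integral>\<^sup>+y. ennreal (indicator {0<..} y * y powr (a - 1)) * indicator A (y / t) \<partial>lborel)"
    unfolding power_law_def
    by (subst emeasure_density) (auto intro!: nn_integral_cong simp: indicator_def)
  also have "\<dots> = ennreal t * (\<integral>\<^sup>+y. ennreal (indicator {0<..} (t * y) * (t * y) powr (a - 1)) *
      indicator A y \<partial>lborel)"
    using t by (subst nn_integral_real_affine[where c=t and t=0]) auto
  also have "\<dots> = ennreal t * (\<integral>\<^sup>+y. ennreal (t powr (a - 1)) *
      (ennreal (indicator {0<..} y * y powr (a - 1)) * indicator A y) \<partial>lborel)"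
    using t by (intro arg_cong[where f="\<lambda>i. ennreal t * i"], intro nn_integral_cong)
      (auto simp: indicator_def powr_mult ennreal_mult zero_less_mult_iff)
  also have "\<dots> = (ennreal t * ennreal (t powr (a - 1))) * emeasure (power_law a) A"
    unfolding power_law_def by (subst nn_integral_cmult) (auto simp: emeasure_density mult.assoc)
  also have "ennreal t * ennreal (t powr (a - 1)) = ennreal (t powr a)"
    using t by (simp add: ennreal_mult[symmetric] powr_diff)
  finally show ?thesis .
qed

text \<open>
  The sum of independent gamma variables is independent of the direction of the vector that they
  form, the latter being represented by the scale-invariant events \<open>B\<close>.
\<close>

lemma gamma_sum_indep_scale_invariant:
  fixes I :: "'i set" and a \<theta> :: real
  defines "G \<equiv> density lborel (\<lambda>y. ennreal (gamma_density a \<theta> y))"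
  assumes fin: "finite I" and ne: "I \<noteq> {}" and a: "0 < a" and \<theta>: "0 < \<theta>"
    and G: "prob_space G"
    and B: "B \<in> sets (PiM I (\<lambda>_. borel))" and A: "A \<in> sets borel"
    and invariant: "\<And>w t. w \<in> space (PiM I (\<lambda>_. borel)) \<Longrightarrow> 0 < t \<Longrightarrow>
      (\<lambda>i\<in>I. w i / t) \<in> B \<longleftrightarrow> w \<in> B"
  shows "emeasure (PiM I (\<lambda>_. G)) {w \<in> B. (\<Sum>i\<in>I. w i) \<in> A} =
    emeasure (PiM I (\<lambda>_. G)) B *
    emeasure (PiM I (\<lambda>_. G)) {w \<in> space (PiM I (\<lambda>_. borel)). (\<Sum>i\<in>I. w i) \<in> A}"
proof -
  let ?K = "power_law a"
  let ?N = "PiM I (\<lambda>_. ?K)"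
  define S where "S w = (\<Sum>i\<in>I. w i)" for w :: "'i \<Rightarrow> real"
  define C where "C = 1 / (Gamma a * \<theta> powr a)"
  define h where "h s = ennreal (C ^ card I * exp (- s / \<theta>))" for s
  have C: "0 < C"
    using a \<theta> by (simp add: C_def Gamma_real_pos)
  have sets_N: "sets ?N = sets (PiM I (\<lambda>_. borel))"
    by (intro sets_PiM_cong) auto
  have space_N: "space ?N = space (PiM I (\<lambda>_. borel))"
    by (rule sets_eq_imp_space_eq[OF sets_N])
  have S[measurable]: "S \<in> borel_measurable ?N"
    unfolding S_def by measurable
  have h[measurable]: "h \<in> borel_measurable borel"
    unfolding h_def by measurable
  have "G = density ?K (\<lambda>y. ennreal (C * exp (- y / \<theta>)))"
    unfolding G_def power_law_def using C
    by (subst density_density_eq)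
      (auto intro!: density_cong simp: gamma_density_def C_def ennreal_mult[symmetric] indicator_def)
  moreover from this have "sigma_finite_measure (density ?K (\<lambda>y. ennreal (C * exp (- y / \<theta>))))"
    using prob_space_imp_sigma_finite[OF G] by simp
  moreover have "(\<Prod>i\<in>I. ennreal (C * exp (- w i / \<theta>))) = h (S w)" for w
    using C fin exp_sum[OF fin, of "\<lambda>i. - w i / \<theta>"]
    by (simp add: prod_ennreal prod.distrib h_def S_def sum_negf sum_divide_distrib)
  ultimately have L: "PiM I (\<lambda>_. G) = density ?N (\<lambda>w. h (S w))"
    using density_PiM[OF fin sigma_finite_power_law[of a], of "\<lambda>y. ennreal (C * exp (- y / \<theta>))"]
    by simp
  have prob_L: "prob_space (PiM I (\<lambda>_. G))"
    using G by (intro prob_space_PiM)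
  have "AE w in PiM I (\<lambda>_. G). 0 < S w"
  proof -
    have "AE y in G. 0 < y"
      unfolding G_def by (subst AE_density) (auto simp: gamma_density_def)
    then have "AE w in PiM I (\<lambda>_. G). \<forall>i\<in>I. 0 < w i"
      using fin G by (intro AE_finite_allI AE_PiM_component)
    then show ?thesis
      by eventually_elim (use fin ne in \<open>auto simp: S_def intro!: sum_pos\<close>)
  qed
  then have pos: "AE w in ?N. 0 < S w"
    unfolding L using C by (subst (asm) AE_density) (auto simp: h_def)
  \<comment> \<open>As \<open>h\<close> decreases, \<open>h 1\<close> times the mass of \<open>{S \<le> 1}\<close> is at most a probability.\<close>
  have "h 1 * emeasure ?N {w \<in> space ?N. S w \<le> 1} =
      (\<integral>\<^sup>+w. h 1 * indicator {w \<in> space ?N. S w \<le> 1} w \<partial>?N)"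
    by (subst nn_integral_cmult_indicator) auto
  also have "\<dots> \<le> (\<integral>\<^sup>+w. h (S w) * indicator {w \<in> space ?N. S w \<le> 1} w \<partial>?N)"
    using C \<theta> by (intro nn_integral_mono)
      (auto simp: indicator_def h_def intro!: ennreal_leI divide_right_mono)
  also have "\<dots> = emeasure (PiM I (\<lambda>_. G)) {w \<in> space ?N. S w \<le> 1}"
    by (simp add: L emeasure_density)
  also have "\<dots> \<le> 1"
    using prob_L by (intro prob_space.emeasure_le_1)
  finally have fin_N: "emeasure ?N {w \<in> space ?N. S w \<le> 1} \<noteq> \<infinity>"
    using C by (auto simp: h_def ennreal_mult_top top_unique)
  have hom: "emeasure ?N {w \<in> D. S w \<le> s} =
      ennreal (s powr (a * card I)) * emeasure ?N {w \<in> D. S w \<le> 1}"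
    if D: "D \<in> {B, space ?N}" and s: "0 < s" for D s
  proof -
    have [measurable]: "D \<in> sets ?N"
      using D B sets_N by auto
    have "{w \<in> D. S w \<le> 1} = D \<inter> {w \<in> space ?N. S w \<le> 1}"
      using sets.sets_into_space[OF \<open>D \<in> sets ?N\<close>] by auto
    then have meas: "{w \<in> D. S w \<le> 1} \<in> sets ?N"
      by simp
    have D_inv: "(\<lambda>i\<in>I. w i / s) \<in> D \<longleftrightarrow> w \<in> D" if "w \<in> space ?N" for w
      using D invariant[of w s] that s space_N by (auto simp: space_PiM)
    have S_div: "S (\<lambda>i\<in>I. w i / s) = S w / s" for w
      by (simp add: S_def sum_divide_distrib)
    have "{w \<in> space ?N. (\<lambda>i\<in>I. w i / s) \<in> {w \<in> D. S w \<le> 1}} = {w \<in> D. S w \<le> s}"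
      using s sets.sets_into_space[OF \<open>D \<in> sets ?N\<close>] by (auto simp: D_inv S_div)
    then show ?thesis
      using homogeneous_PiM[OF fin sigma_finite_power_law sets_power_law
        homogeneous_power_law[OF s] s meas] by simp
  qed
  show ?thesis
    using homogeneous_measure_independence[OF S h _ A pos fin_N hom] B prob_L sets_N
    by (simp add: L S_def space_N)
qed

section \<open>Scale invariance and measurability of the pairing\<close>

lemma approaching_cong:
  assumes "\<And>i. i \<in> A \<Longrightarrow> v i = v' i"
  shows "approaching v A = approaching v' A"
  using assms by (auto simp: approaching_def)

lemma first_meetings_eq:
  assumes "finite A"
  shows "first_meetings x v A = {e \<in> approaching v A. \<forall>e'\<in>approaching v A.
    meeting_time x v e \<le> meeting_time x v e'}"
proof -
  have "finite (approaching v A)"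
    by (rule finite_subset[of _ "A \<times> A"]) (use assms in \<open>auto simp: approaching_def\<close>)
  then show ?thesis
    by (auto simp: first_meetings_def intro!: antisym[OF _ Min_le] Min.boundedI)
qed

text \<open>
  The dynamics consults the positions only to find out which of the pairs still alive meet first,
  so it depends on nothing but the order, ties included, of the meeting times of all pairs.
\<close>

lemma pairing_eqI:
  assumes v: "\<And>i. i \<in> {1..n} \<Longrightarrow> v i = v' i" and c: "\<And>i. i \<in> {1..n} \<Longrightarrow> c i = c' i"
    and order: "\<And>e e'. e \<in> {1..n} \<times> {1..n} \<Longrightarrow> e' \<in> {1..n} \<times> {1..n} \<Longrightarrow>
      meeting_time x v e \<le> meeting_time x v e' \<longleftrightarrow> meeting_time x' v' e \<le> meeting_time x' v' e'"
  shows "pairing n x v c = pairing n x' v' c'"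
proof -
  have meet: "first_meetings x v A = first_meetings x' v' A" if A: "A \<subseteq> {1..n}" for A
  proof -
    have "finite A"
      using A finite_subset by blast
    moreover have "approaching v A = approaching v' A"
      using A v by (intro approaching_cong) auto
    moreover have "approaching v' A \<subseteq> {1..n} \<times> {1..n}"
      using A by (auto simp: approaching_def)
    ultimately show ?thesis
      using order by (auto simp: first_meetings_eq subset_iff)
  qed
  have "first_annihilations x v c A = first_annihilations x' v' c' A" if A: "A \<subseteq> {1..n}" for A
  proof -
    have "i \<in> {1..n} \<and> j \<in> {1..n}" if "(i, j) \<in> first_meetings x' v' A" for i j
      using that A by (auto simp: first_meetings_def approaching_def)
    then show ?thesis
      using c by (fastforce simp: first_annihilations_def meet[OF A])
  qed
  then have "annihilations n x v c k = annihilations n x' v' c' k" for k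
    by (induction k) auto
  then have "annihilated n x v c = annihilated n x' v' c'"
    by (intro ext) (simp add: annihilated_def)
  then show ?thesis
    by (intro ext) (simp add: pairing_def)
qed

lemma pairing_scale:
  assumes "0 < t"
  shows "pairing n (\<lambda>k. x k / t) v c = pairing n x v c"
proof (rule pairing_eqI)
  have "meeting_time (\<lambda>k. x k / t) v e = meeting_time x v e / t" for e
    by (cases e) (simp add: meeting_time_def diff_divide_distrib mult.commute)
  then show "meeting_time (\<lambda>k. x k / t) v e \<le> meeting_time (\<lambda>k. x k / t) v e' \<longleftrightarrow>
      meeting_time x v e \<le> meeting_time x v e'" for e e'
    using assms by (simp add: divide_le_cancel)
qed auto

text \<open>
  Since there are finitely many pairs, their meeting times have finitely many order patterns, and
  each pattern is described by finitely many inequalities between measurable functions.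
\<close>

lemma measurable_pairing:
  assumes x[measurable]: "\<And>k. k \<in> {1..n} \<Longrightarrow> x k \<in> borel_measurable M"
  shows "(\<lambda>w. pairing n (\<lambda>k. x k w) v c) \<in> measurable M (count_space UNIV)"
proof -
  define Q where "Q = ({1..n} \<times> {1..n}) \<times> ({1..n} \<times> {1..n})"
  \<comment> \<open>The order pattern; by \<open>pairing_eqI\<close>, the pairing is a function \<open>G\<close> of it.\<close>
  define T where "T y = {q \<in> Q. meeting_time y v (fst q) \<le> meeting_time y v (snd q)}"
    for y :: "nat \<Rightarrow> real"
  define G where "G s = pairing n (SOME y. T y = s) v c" for s
  have Q: "finite Q"
    by (simp add: Q_def)
  have "pairing n y v c = G (T y)" for y
  proof -
    define y' where "y' = (SOME y'. T y' = T y)"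
    have y': "T y' = T y"
      unfolding y'_def by (rule someI[where x=y]) simp
    have "pairing n y v c = pairing n y' v c"
    proof (rule pairing_eqI)
      fix e e' assume "e \<in> {1..n} \<times> {1..n}" "e' \<in> {1..n} \<times> {1..n}"
      then have "(e, e') \<in> Q"
        by (simp add: Q_def)
      then show "meeting_time y v e \<le> meeting_time y v e' \<longleftrightarrow> meeting_time y' v e \<le> meeting_time y' v e'"
        using arg_cong[OF y', of "\<lambda>s. (e, e') \<in> s"] by (simp add: T_def)
    qed auto
    then show ?thesis
      by (simp add: G_def y'_def)
  qed
  moreover have "(\<lambda>w. T (\<lambda>k. x k w)) \<in> measurable M (count_space (Pow Q))"
  proof (subst measurable_count_space_eq_countable)
    show "countable (Pow Q)"
      using Q by (simp add: countable_finite)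
    show "(\<lambda>w. T (\<lambda>k. x k w)) \<in> space M \<rightarrow> Pow Q \<and>
      (\<forall>s\<in>Pow Q. (\<lambda>w. T (\<lambda>k. x k w)) -` {s} \<inter> space M \<in> sets M)"
    proof (intro conjI ballI)
      fix s assume s: "s \<in> Pow Q"
      have meet[measurable]: "(\<lambda>w. meeting_time (\<lambda>k. x k w) v e) \<in> borel_measurable M"
        if "e \<in> {1..n} \<times> {1..n}" for e
        using that x by (cases e) (auto simp: meeting_time_def)
      have "(\<lambda>w. T (\<lambda>k. x k w)) -` {s} \<inter> space M = {w \<in> space M. \<forall>q\<in>Q.
          q \<in> s \<longleftrightarrow> meeting_time (\<lambda>k. x k w) v (fst q) \<le> meeting_time (\<lambda>k. x k w) v (snd q)}"
        using s by (auto simp: T_def)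
      also have "\<dots> \<in> sets M"
      proof (rule sets.sets_Collect_finite_All[OF _ Q])
        fix q assume "q \<in> Q"
        then have [measurable]: "fst q \<in> {1..n} \<times> {1..n}" "snd q \<in> {1..n} \<times> {1..n}"
          by (auto simp: Q_def)
        show "{w \<in> space M. q \<in> s \<longleftrightarrow>
            meeting_time (\<lambda>k. x k w) v (fst q) \<le> meeting_time (\<lambda>k. x k w) v (snd q)} \<in> sets M"
          by measurable
      qed
      finally show "(\<lambda>w. T (\<lambda>k. x k w)) -` {s} \<inter> space M \<in> sets M" .
    qed (auto simp: T_def)
  qed
  then have "(\<lambda>w. G (T (\<lambda>k. x k w))) \<in> measurable M (count_space UNIV)"
    by (rule measurable_compose) simp
  ultimately show ?thesis
    by simp
qed

section \<open>Independence of velocities, coins and lengths\<close>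

text \<open>
  Conditioning on a discrete variable \<open>Z\<close> independent of \<open>X\<close>: if \<open>g X\<close> is independent of
  \<open>f z X\<close> for each value \<open>z\<close> of \<open>Z\<close>, it is independent of \<open>f Z X\<close>. The
  conditional law of \<open>g X\<close> given \<open>Z = z\<close> is the same for all \<open>z\<close>; otherwise \<open>Z\<close> could correlate
  the two.
\<close>

lemma indep_rvs_mixture:
  fixes X :: "'a \<Rightarrow> 'b" and Z :: "'a \<Rightarrow> 'z" and g :: "'b \<Rightarrow> real" and f :: "'z \<Rightarrow> 'b \<Rightarrow> 'c"
  assumes "prob_space M" and X[measurable]: "X \<in> measurable M N"
    and Z[measurable]: "Z \<in> measurable M (count_space K)" and K: "countable K"
    and g[measurable]: "g \<in> borel_measurable N"
    and f[measurable]: "\<And>z. z \<in> K \<Longrightarrow> f z \<in> measurable N (count_space UNIV)"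
    and indep: "\<And>B z. B \<in> sets N \<Longrightarrow> z \<in> K \<Longrightarrow>
      measure M ((X -` B \<inter> space M) \<inter> (Z -` {z} \<inter> space M)) =
      measure M (X -` B \<inter> space M) * measure M (Z -` {z} \<inter> space M)"
    and cond: "\<And>A D z. A \<in> sets borel \<Longrightarrow> z \<in> K \<Longrightarrow>
      emeasure (distr M N X) {w \<in> space N. g w \<in> A \<and> f z w \<in> D} =
      emeasure (distr M N X) {w \<in> space N. g w \<in> A} * emeasure (distr M N X) {w \<in> space N. f z w \<in> D}"
  shows "indep_rvs M borel (\<lambda>\<omega>. g (X \<omega>)) (count_space UNIV) (\<lambda>\<omega>. f (Z \<omega>) (X \<omega>))"
proof -
  interpret prob_space M
    by fact
  have gX[measurable]: "(\<lambda>\<omega>. g (X \<omega>)) \<in> borel_measurable M"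
    by measurable
  have fZX[measurable]: "(\<lambda>\<omega>. f (Z \<omega>) (X \<omega>)) \<in> measurable M (count_space UNIV)"
    by (rule measurable_compose_countable'[OF _ Z K]) measurable
  have split: "emeasure M {\<omega> \<in> space M. g (X \<omega>) \<in> A \<and> f (Z \<omega>) (X \<omega>) \<in> D} =
      (\<integral>\<^sup>+z. emeasure (distr M N X) {w \<in> space N. g w \<in> A} *
        (emeasure (distr M N X) {w \<in> space N. f z w \<in> D} * emeasure M (Z -` {z} \<inter> space M))
        \<partial>count_space K)"
    if A[measurable]: "A \<in> sets borel" for A D
  proof -
    let ?B = "\<lambda>z. {w \<in> space N. g w \<in> A \<and> f z w \<in> D}"
    let ?E = "\<lambda>z. (X -` ?B z \<inter> space M) \<inter> (Z -` {z} \<inter> space M)"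
    have B[measurable]: "?B z \<in> sets N" if "z \<in> K" for z
    proof -
      have "?B z = (g -` A \<inter> space N) \<inter> (f z -` D \<inter> space N)"
        by auto
      then show ?thesis
        using measurable_sets[OF f[OF that], of D] by simp
    qed
    have Zz[measurable]: "Z -` {z} \<inter> space M \<in> sets M" if "z \<in> K" for z
      using that by (intro measurable_sets[OF Z]) auto
    have "{\<omega> \<in> space M. g (X \<omega>) \<in> A \<and> f (Z \<omega>) (X \<omega>) \<in> D} = (\<Union>z\<in>K. ?E z)"
      using measurable_space[OF Z] measurable_space[OF X] by auto
    also have "emeasure M \<dots> = (\<integral>\<^sup>+z. emeasure M (?E z) \<partial>count_space K)"
      using K by (intro emeasure_UN_countable) (auto simp: disjoint_family_on_def)
    also have "\<dots> = (\<integral>\<^sup>+z. emeasure (distr M N X) {w \<in> space N. g w \<in> A} *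
        (emeasure (distr M N X) {w \<in> space N. f z w \<in> D} * emeasure M (Z -` {z} \<inter> space M))
        \<partial>count_space K)"
    proof (rule nn_integral_cong)
      fix z assume "z \<in> space (count_space K)"
      then have z: "z \<in> K"
        by simp
      have "emeasure M (?E z) = emeasure M (X -` ?B z \<inter> space M) * emeasure M (Z -` {z} \<inter> space M)"
        using indep[OF B[OF z] z] by (simp add: emeasure_eq_measure ennreal_mult)
      also have "emeasure M (X -` ?B z \<inter> space M) = emeasure (distr M N X) (?B z)"
        using B[OF z] by (simp add: emeasure_distr)
      finally show "emeasure M (?E z) = emeasure (distr M N X) {w \<in> space N. g w \<in> A} *
          (emeasure (distr M N X) {w \<in> space N. f z w \<in> D} * emeasure M (Z -` {z} \<inter> space M))"
        using cond[OF A z] by (simp add: mult.assoc)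
    qed
    finally show ?thesis .
  qed
  have gX_distr: "emeasure (distr M N X) {w \<in> space N. g w \<in> A} = emeasure M {\<omega> \<in> space M. g (X \<omega>) \<in> A}"
    if [measurable]: "A \<in> sets borel" for A
    using measurable_space[OF X] by (subst emeasure_distr) (auto intro!: arg_cong2[where f=emeasure])
  have mult: "emeasure M {\<omega> \<in> space M. g (X \<omega>) \<in> A \<and> f (Z \<omega>) (X \<omega>) \<in> D} =
      emeasure M {\<omega> \<in> space M. g (X \<omega>) \<in> A} * emeasure M {\<omega> \<in> space M. f (Z \<omega>) (X \<omega>) \<in> D}"
    if A: "A \<in> sets borel" for A D
    using split[OF A, of D] split[of UNIV D] gX_distr[OF A] gX_distr[of UNIV]
    by (simp add: nn_integral_cmult emeasure_space_1)
  show ?thesis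
    unfolding indep_rvs_def indep_sets2_eq
  proof (intro conjI subsetI ballI)
    fix a b assume "a \<in> {(\<lambda>\<omega>. g (X \<omega>)) -` A \<inter> space M |A. A \<in> sets borel}"
      and "b \<in> {(\<lambda>\<omega>. f (Z \<omega>) (X \<omega>)) -` D \<inter> space M |D. D \<in> sets (count_space UNIV)}"
    then obtain A D where A: "A \<in> sets borel" and a: "a = {\<omega> \<in> space M. g (X \<omega>) \<in> A}"
      and b: "b = {\<omega> \<in> space M. f (Z \<omega>) (X \<omega>) \<in> D}"
      by auto
    have "a \<inter> b = {\<omega> \<in> space M. g (X \<omega>) \<in> A \<and> f (Z \<omega>) (X \<omega>) \<in> D}"
      by (auto simp: a b)
    then have "emeasure M (a \<inter> b) = emeasure M a * emeasure M b"
      using mult[OF A, of D] by (simp add: a b)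
    then show "prob (a \<inter> b) = prob a * prob b"
      by (simp add: measure_def enn2real_mult)
  qed (auto intro!: measurable_sets[OF gX] measurable_sets[OF fZX])
qed

lemma indep_rvsD:
  assumes "prob_space M" "indep_rvs M S X T Y" "A \<in> sets S" "B \<in> sets T"
  shows "measure M ((X -` A \<inter> space M) \<inter> (Y -` B \<inter> space M)) =
    measure M (X -` A \<inter> space M) * measure M (Y -` B \<inter> space M)"
  using assms prob_space.indep_setD[OF assms(1)] unfolding indep_rvs_def by blast

lemma sets_PiM_finite_cylinder:
  assumes "finite J" "J \<subseteq> I"
  shows "{u \<in> space (PiM I (\<lambda>_. count_space UNIV)). \<forall>i\<in>J. u i = z i} \<in> sets (PiM I (\<lambda>_. count_space UNIV))"
proof (rule sets.sets_Collect_finite_All[OF _ assms(1)])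
  fix i assume "i \<in> J"
  then have "i \<in> I"
    using assms(2) by auto
  then have "(\<lambda>u. u i) -` {z i} \<inter> space (PiM I (\<lambda>_. count_space UNIV)) \<in> sets (PiM I (\<lambda>_. count_space UNIV))"
    by (intro measurable_sets[OF measurable_component_singleton]) auto
  then show "{u \<in> space (PiM I (\<lambda>_. count_space UNIV)). u i = z i} \<in> sets (PiM I (\<lambda>_. count_space UNIV))"
    by (simp add: vimage_def Int_def conj_commute)
qed

section \<open>Independence of the last position and the configuration\<close>

theorem theorem5:
  fixes M :: "'a measure"
    and l :: "nat \<Rightarrow> 'a \<Rightarrow> real"
    and v :: "nat \<Rightarrow> 'a \<Rightarrow> int"
    and c :: "nat \<Rightarrow> 'a \<Rightarrow> bool"
    and x :: "nat \<Rightarrow> 'a \<Rightarrow> real"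
    and p r shape scale :: real
    and n :: nat
  assumes "prob_space M"
    and "0 < p" and "p < 1" and "0 < r" and "r < 1"
    and "0 < shape" and "0 < scale"
    and "prob_space.indep_vars M (\<lambda>_. borel) l {1..}"
    and "\<And>k. k \<ge> 1 \<Longrightarrow> distributed M lborel (l k) (\<lambda>y. ennreal (gamma_density shape scale y))"
    and "prob_space.indep_vars M (\<lambda>_. count_space UNIV) v {1..}"
    and "\<And>k. k \<ge> 1 \<Longrightarrow> distr M (count_space UNIV) (v k) = measure_pmf (velocity_pmf p r)"
    and "prob_space.indep_vars M (\<lambda>_. count_space UNIV) c {1..}"
    and "\<And>k. k \<ge> 1 \<Longrightarrow> distr M (count_space UNIV) (c k) = measure_pmf (bernoulli_pmf (1 / 2))"
    and "indep_rvs M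
           (PiM {1..} (\<lambda>_. borel)) (\<lambda>\<omega>. \<lambda>k\<in>{1..}. l k \<omega>)
           (PiM {1..} (\<lambda>_. count_space UNIV)) (\<lambda>\<omega>. \<lambda>k\<in>{1..}. v k \<omega>)"
    and "indep_rvs M
           (PiM {1..} (\<lambda>_. borel) \<Otimes>\<^sub>M PiM {1..} (\<lambda>_. count_space UNIV))
           (\<lambda>\<omega>. ((\<lambda>k\<in>{1..}. l k \<omega>), (\<lambda>k\<in>{1..}. v k \<omega>)))
           (PiM {1..} (\<lambda>_. count_space UNIV)) (\<lambda>\<omega>. \<lambda>k\<in>{1..}. c k \<omega>)"
    and "\<And>k \<omega>. x k \<omega> = (\<Sum>i = 1..k. l i \<omega>)"
    and "n \<ge> 1"
  shows "indep_rvs M borel (x n) (count_space UNIV)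
           (\<lambda>\<omega>. ((\<lambda>k\<in>{1..n}. v k \<omega>),
                 pairing n (\<lambda>k. x k \<omega>) (\<lambda>k. v k \<omega>) (\<lambda>k. c k \<omega>)))"
proof -
  interpret prob_space M
    by fact
  let ?I = "{1..n}"
  define G where "G = density lborel (\<lambda>y. ennreal (gamma_density shape scale y))"
  define X where "X \<omega> = (\<lambda>i\<in>?I. l i \<omega>)" for \<omega>
  define Z where "Z \<omega> = ((\<lambda>i\<in>?I. v i \<omega>), (\<lambda>i\<in>?I. c i \<omega>))" for \<omega>
  \<comment> \<open>Restricted to \<open>{1..n}\<close>, velocities and coins take their values in a countable set.\<close>
  define K where "K = (\<Pi>\<^sub>E i\<in>?I. UNIV :: int set) \<times> (\<Pi>\<^sub>E i\<in>?I. UNIV :: bool set)"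
  define S where "S w = (\<Sum>i\<in>?I. w i)" for w :: "nat \<Rightarrow> real"
  define f where "f z w = (fst z, pairing n (\<lambda>k. \<Sum>i = 1..k. w i) (fst z) (snd z))"
    for z :: "(nat \<Rightarrow> int) \<times> (nat \<Rightarrow> bool)" and w :: "nat \<Rightarrow> real"
  have l_distr: "distr M borel (l k) = G" and l[measurable]: "l k \<in> borel_measurable M"
    if "k \<ge> 1" for k
  proof -
    have "distr M lborel (l k) = G" and "l k \<in> measurable M lborel"
      using assms(9)[OF that] by (simp_all add: distributed_def G_def)
    then show "distr M borel (l k) = G" and "l k \<in> borel_measurable M"
      by (simp_all cong: distr_cong)
  qed
  have G: "prob_space G"
    using l_distr[of 1] prob_space_distr[OF l[of 1]] by simp
  have X[measurable]: "X \<in> measurable M (PiM ?I (\<lambda>_. borel))"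
    unfolding X_def by measurable
  have X_distr: "distr M (PiM ?I (\<lambda>_. borel)) X = PiM ?I (\<lambda>_. G)"
  proof -
    have "indep_vars (\<lambda>_. borel) l ?I"
      by (rule indep_vars_subset[OF assms(8)]) auto
    then have "distr M (PiM ?I (\<lambda>_. borel)) X = PiM ?I (\<lambda>i. distr M borel (l i))"
      unfolding X_def using \<open>n \<ge> 1\<close> l
      by (subst (asm) indep_vars_iff_distr_eq_PiM') auto
    also have "\<dots> = PiM ?I (\<lambda>_. G)"
      by (intro PiM_cong) (auto intro: l_distr)
    finally show ?thesis .
  qed
  have v: "v k \<in> measurable M (count_space UNIV)" if "k \<in> ?I" for k
    using assms(10) that by (auto simp: indep_vars_def)
  have c: "c k \<in> measurable M (count_space UNIV)" if "k \<in> ?I" for k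
    using assms(12) that by (auto simp: indep_vars_def)
  have K: "countable K"
    unfolding K_def by (intro countable_SIGMA countable_PiE) auto
  let ?LL = "PiM {1::nat..} (\<lambda>_. borel :: real measure)"
  let ?VV = "PiM {1::nat..} (\<lambda>_. count_space (UNIV :: int set))"
  let ?CC = "PiM {1::nat..} (\<lambda>_. count_space (UNIV :: bool set))"
  let ?l = "\<lambda>\<omega>. \<lambda>k\<in>{1..}. l k \<omega>" and ?v = "\<lambda>\<omega>. \<lambda>k\<in>{1..}. v k \<omega>" and ?c = "\<lambda>\<omega>. \<lambda>k\<in>{1..}. c k \<omega>"
  have lv: "(\<lambda>\<omega>. (?l \<omega>, ?v \<omega>)) \<in> measurable M (?LL \<Otimes>\<^sub>M ?VV)"
    using assms(15) by (simp add: indep_rvs_def)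
  have lm: "?l \<in> measurable M ?LL" and vm: "?v \<in> measurable M ?VV" and cm: "?c \<in> measurable M ?CC"
    using assms(14,15) by (simp_all add: indep_rvs_def)
  define V where "V z = {u \<in> space ?VV. \<forall>i\<in>?I. u i = fst z i}" for z :: "(nat \<Rightarrow> int) \<times> (nat \<Rightarrow> bool)"
  define W where "W z = {u \<in> space ?CC. \<forall>i\<in>?I. u i = snd z i}" for z :: "(nat \<Rightarrow> int) \<times> (nat \<Rightarrow> bool)"
  have V: "V z \<in> sets ?VV" and W: "W z \<in> sets ?CC" for z
    unfolding V_def W_def by (intro sets_PiM_finite_cylinder; force)+
  have Z_eq: "Z -` {z} \<inter> space M = (?v -` V z \<inter> space M) \<inter> (?c -` W z \<inter> space M)" if "z \<in> K" for z
  proof -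
    have "Z \<omega> = z \<longleftrightarrow> (\<forall>i\<in>?I. v i \<omega> = fst z i) \<and> (\<forall>i\<in>?I. c i \<omega> = snd z i)" for \<omega>
      using that by (cases z) (auto simp: Z_def K_def fun_eq_iff PiE_iff extensional_def)
    then show ?thesis
      by (auto simp: V_def W_def space_PiM)
  qed
  have Z[measurable]: "Z \<in> measurable M (count_space K)"
    using measurable_sets[OF vm V] measurable_sets[OF cm W]
    by (subst measurable_count_space_eq_countable[OF K]) (auto simp: Z_eq, auto simp: Z_def K_def)
  have indep: "measure M ((X -` B \<inter> space M) \<inter> (Z -` {z} \<inter> space M)) =
      measure M (X -` B \<inter> space M) * measure M (Z -` {z} \<inter> space M)"
    if B: "B \<in> sets (PiM ?I (\<lambda>_. borel))" and z: "z \<in> K" for B z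
  proof -
    define B' where "B' = (\<lambda>w. restrict w ?I) -` B \<inter> space ?LL"
    have B': "B' \<in> sets ?LL"
      unfolding B'_def using B by (intro measurable_sets[OF measurable_restrict_subset]) auto
    have XB: "X -` B \<inter> space M = ?l -` B' \<inter> space M"
    proof -
      have "restrict (?l \<omega>) ?I = X \<omega>" for \<omega>
        by (auto simp: X_def)
      then show ?thesis
        using measurable_space[OF lm] by (auto simp: B'_def)
    qed
    \<comment> \<open>The two independence hypotheses together split lengths, velocities and coins into three factors.\<close>
    have lvc: "prob ((?l -` E \<inter> space M) \<inter> (Z -` {z} \<inter> space M)) =
        prob (?l -` E \<inter> space M) * prob (?v -` V z \<inter> space M) * prob (?c -` W z \<inter> space M)"
      if E: "E \<in> sets ?LL" for E
    proof -
      have "(?l -` E \<inter> space M) \<inter> (Z -` {z} \<inter> space M) =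
          ((\<lambda>\<omega>. (?l \<omega>, ?v \<omega>)) -` (E \<times> V z) \<inter> space M) \<inter> (?c -` W z \<inter> space M)"
        by (auto simp: Z_eq[OF z])
      moreover have "E \<times> V z \<in> sets (?LL \<Otimes>\<^sub>M ?VV)"
        using E V by simp
      moreover have "(\<lambda>\<omega>. (?l \<omega>, ?v \<omega>)) -` (E \<times> V z) \<inter> space M =
          (?l -` E \<inter> space M) \<inter> (?v -` V z \<inter> space M)"
        by auto
      ultimately show ?thesis
        using indep_rvsD[OF assms(1,15) _ W, of "E \<times> V z" z]
          indep_rvsD[OF assms(1,14) E V, of z] by simp
    qed
    have "?l -` space ?LL \<inter> space M = space M"
      using measurable_space[OF lm] by auto
    then have "prob (Z -` {z} \<inter> space M) = prob (?v -` V z \<inter> space M) * prob (?c -` W z \<inter> space M)"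
      using lvc[of "space ?LL"] by (simp add: prob_space Int_absorb1)
    then show ?thesis
      using lvc[OF B'] by (simp add: XB)
  qed
  have f: "f z \<in> measurable (PiM ?I (\<lambda>_. borel)) (count_space UNIV)" for z
  proof -
    have "(\<lambda>w. pairing n (\<lambda>k. \<Sum>i = 1..k. w i) (fst z) (snd z)) \<in>
        measurable (PiM ?I (\<lambda>_. borel)) (count_space UNIV)"
      by (intro measurable_pairing borel_measurable_sum measurable_component_singleton) auto
    then show ?thesis
      unfolding f_def by (rule measurable_compose) simp
  qed
  have S: "S \<in> borel_measurable (PiM ?I (\<lambda>_. borel))"
    unfolding S_def by measurable
  \<comment> \<open>Dilating the lengths dilates all positions, on \<open>{1..n}\<close> at least.\<close>
  have f_scale: "f z (\<lambda>i\<in>?I. w i / t) = f z w" if "0 < t" for z w t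
  proof -
    have "pairing n (\<lambda>k. \<Sum>i = 1..k. (\<lambda>i\<in>?I. w i / t) i) (fst z) (snd z) =
        pairing n (\<lambda>k. (\<Sum>i = 1..k. w i) / t) (fst z) (snd z)"
    proof (rule pairing_eqI)
      have "(\<Sum>i = 1..k. (\<lambda>i\<in>?I. w i / t) i) = (\<Sum>i = 1..k. w i) / t" if "k \<in> ?I" for k
        unfolding sum_divide_distrib using that by (intro sum.cong) auto
      then have "meeting_time (\<lambda>k. \<Sum>i = 1..k. (\<lambda>i\<in>?I. w i / t) i) (fst z) e =
          meeting_time (\<lambda>k. (\<Sum>i = 1..k. w i) / t) (fst z) e" if "e \<in> ?I \<times> ?I" for e
        using that by (auto simp: meeting_time_def simp del: restrict_apply)
      then show "meeting_time (\<lambda>k. \<Sum>i = 1..k. (\<lambda>i\<in>?I. w i / t) i) (fst z) e \<le>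
            meeting_time (\<lambda>k. \<Sum>i = 1..k. (\<lambda>i\<in>?I. w i / t) i) (fst z) e' \<longleftrightarrow>
          meeting_time (\<lambda>k. (\<Sum>i = 1..k. w i) / t) (fst z) e \<le>
            meeting_time (\<lambda>k. (\<Sum>i = 1..k. w i) / t) (fst z) e'"
        if "e \<in> ?I \<times> ?I" "e' \<in> ?I \<times> ?I" for e e'
        using that by simp
    qed auto
    then show ?thesis
      using pairing_scale[OF that] by (simp add: f_def)
  qed
  have cond: "emeasure (distr M (PiM ?I (\<lambda>_. borel)) X)
        {w \<in> space (PiM ?I (\<lambda>_. borel)). S w \<in> A \<and> f z w \<in> D} =
      emeasure (distr M (PiM ?I (\<lambda>_. borel)) X) {w \<in> space (PiM ?I (\<lambda>_. borel)). S w \<in> A} *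
      emeasure (distr M (PiM ?I (\<lambda>_. borel)) X) {w \<in> space (PiM ?I (\<lambda>_. borel)). f z w \<in> D}"
    if A: "A \<in> sets borel" for A D z
  proof -
    let ?B = "{w \<in> space (PiM ?I (\<lambda>_. borel)). f z w \<in> D}"
    have "?B = f z -` D \<inter> space (PiM ?I (\<lambda>_. borel))"
      by auto
    then have B: "?B \<in> sets (PiM ?I (\<lambda>_. borel))"
      using measurable_sets[OF f, of D] by simp
    have inv: "(\<lambda>i\<in>?I. w i / t) \<in> ?B \<longleftrightarrow> w \<in> ?B"
      if "w \<in> space (PiM ?I (\<lambda>_. borel))" "0 < t" for w t
      using that f_scale[OF that(2), of z w] by (simp add: space_PiM)
    have "{w \<in> ?B. (\<Sum>i\<in>?I. w i) \<in> A} = {w \<in> space (PiM ?I (\<lambda>_. borel)). S w \<in> A \<and> f z w \<in> D}"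
      by (auto simp: S_def)
    then show ?thesis
      unfolding X_distr
      using gamma_sum_indep_scale_invariant[OF _ _ \<open>0 < shape\<close> \<open>0 < scale\<close> G[unfolded G_def] B A inv]
        \<open>n \<ge> 1\<close> by (simp add: G_def S_def mult.commute)
  qed
  have "indep_rvs M borel (\<lambda>\<omega>. S (X \<omega>)) (count_space UNIV) (\<lambda>\<omega>. f (Z \<omega>) (X \<omega>))"
    using assms(1) X Z K S f indep cond by (rule indep_rvs_mixture)
  moreover have "(\<lambda>\<omega>. S (X \<omega>)) = x n"
    by (auto simp: S_def X_def assms(16))
  moreover have "f (Z \<omega>) (X \<omega>) =
      ((\<lambda>k\<in>{1..n}. v k \<omega>), pairing n (\<lambda>k. x k \<omega>) (\<lambda>k. v k \<omega>) (\<lambda>k. c k \<omega>))" for \<omega>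
  proof -
    have "pairing n (\<lambda>k. \<Sum>i = 1..k. X \<omega> i) (\<lambda>i\<in>?I. v i \<omega>) (\<lambda>i\<in>?I. c i \<omega>) =
        pairing n (\<lambda>k. x k \<omega>) (\<lambda>k. v k \<omega>) (\<lambda>k. c k \<omega>)"
    proof (rule pairing_eqI)
      have "(\<Sum>i = 1..k. X \<omega> i) = x k \<omega>" if "k \<in> ?I" for k
        unfolding assms(16) X_def using that by (intro sum.cong) auto
      then have "meeting_time (\<lambda>k. \<Sum>i = 1..k. X \<omega> i) (\<lambda>i\<in>?I. v i \<omega>) e =
          meeting_time (\<lambda>k. x k \<omega>) (\<lambda>k. v k \<omega>) e" if "e \<in> ?I \<times> ?I" for e
        using that by (auto simp: meeting_time_def)
      then show "meeting_time (\<lambda>k. \<Sum>i = 1..k. X \<omega> i) (\<lambda>i\<in>?I. v i \<omega>) e \<le>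
            meeting_time (\<lambda>k. \<Sum>i = 1..k. X \<omega> i) (\<lambda>i\<in>?I. v i \<omega>) e' \<longleftrightarrow>
          meeting_time (\<lambda>k. x k \<omega>) (\<lambda>k. v k \<omega>) e \<le> meeting_time (\<lambda>k. x k \<omega>) (\<lambda>k. v k \<omega>) e'"
        if "e \<in> ?I \<times> ?I" "e' \<in> ?I \<times> ?I" for e e'
        using that by simp
    qed auto
    then show ?thesis
      by (simp add: f_def Z_def)
  qed
  ultimately show ?thesis
    by simp
qed

end
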